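(* Let $p$ be any prime and let $a,b$ be integers with $0\le b\le a$. If $a\not\equiv b \pmod{p-1}$, then $S(p^\infty a,p^\infty b)=0$. If $a\equiv b\pmod{p-1}$, then $$S(p^\infty a,p^\infty b)=\binom{p^\infty\frac{pa-b}{p-1}-1}{p^\infty\frac{p(a-b)}{p-1}}.$$
   Context: $S(n,k)$ denotes the Stirling numbers of the second kind (with $S(0,0)=1$). $\mathbb{Z}_p$ is the ring of $p$-adic integers. Define $S(p^\infty a,p^\infty b):=\lim_{e\to\infty}S(p^e a,p^e b)$, the limit being taken in $\mathbb{Z}_p$. For integers $0\le\beta\le\alpha$, define the $p$-adic integer $\binom{p^\infty\alpha-1}{p^\infty\beta}:=\lim_{e\to\infty}\binom{p^e\alpha-1}{p^e\beta}$, the limit being taken in $\mathbb{Z}_p$ (with $\binom{-1}{0}=1$). The existence of the limit $S(p^\infty a,p^\infty b)$ is part of the assertion. *)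

theory Defs
  imports
    "HOL-Analysis.Analysis"
    "HOL-Algebra.Ring"
    "HOL-Combinatorics.Stirling"
    "HOL-Computational_Algebra.Primes"
    "HOL-Number_Theory.Cong"
begin

text \<open>
  The ring of \<open>p\<close>-adic integers is the inverse limit of the rings of integers modulo
  \<open>p ^ n\<close>.  An element \<open>x\<close> is a compatible system of residues, \<open>x n\<close> being its
  representative modulo \<open>p ^ n\<close> in \<open>{0..<p ^ n}\<close>.
\<close>

definition padic_int :: "nat \<Rightarrow> (nat \<Rightarrow> int) ring" where
  "padic_int p =
    \<lparr>carrier = {x. \<forall>n. x n \<in> {0..<int p ^ n} \<and> x (Suc n) mod int p ^ n = x n},
     mult = (\<lambda>x y n. (x n * y n) mod int p ^ n),
     one = (\<lambda>n. 1 mod int p ^ n),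
     zero = (\<lambda>n. 0),
     add = (\<lambda>x y n. (x n + y n) mod int p ^ n)\<rparr>"

definition padic_of_int :: "nat \<Rightarrow> int \<Rightarrow> nat \<Rightarrow> int" where
  "padic_of_int p z = (\<lambda>n. z mod int p ^ n)"

text \<open>
  The \<open>p\<close>-adic topology is the inverse limit topology of the discrete residue rings: the
  cosets of the ideals \<open>p ^ n\<close> are a basis (see \<open>limitin_padic_iff\<close> for
  convergence).
\<close>

definition padic_topology :: "nat \<Rightarrow> (nat \<Rightarrow> int) topology" where
  "padic_topology p =
    subtopology (product_topology (\<lambda>n. discrete_topology {0..<int p ^ n}) UNIV)
      (carrier (padic_int p))"

definition has_padic_limit :: "nat \<Rightarrow> (nat \<Rightarrow> int) \<Rightarrow> (nat \<Rightarrow> int) \<Rightarrow> bool" where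
  "has_padic_limit p X L \<longleftrightarrow>
    limitin (padic_topology p) (\<lambda>e. padic_of_int p (X e)) L sequentially"

definition padic_convergent :: "nat \<Rightarrow> (nat \<Rightarrow> int) \<Rightarrow> bool" where
  "padic_convergent p X \<longleftrightarrow> (\<exists>L. has_padic_limit p X L)"

text \<open>The value of \<open>padic_lim\<close> is unspecified for sequences that do not converge.\<close>

definition padic_lim :: "nat \<Rightarrow> (nat \<Rightarrow> int) \<Rightarrow> nat \<Rightarrow> int" where
  "padic_lim p X = (THE L. has_padic_limit p X L)"

definition Stirling_seq :: "nat \<Rightarrow> nat \<Rightarrow> nat \<Rightarrow> nat \<Rightarrow> int" where
  "Stirling_seq p a b e = int (Stirling (p ^ e * a) (p ^ e * b))"

text \<open>
  For \<open>\<alpha> = 0\<close>, which forces \<open>\<beta> = 0\<close>, the subtraction of naturals turns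
  the upper index \<open>-1\<close> into \<open>0\<close>; the value is \<open>1\<close> under either reading.
\<close>

definition binomial_seq :: "nat \<Rightarrow> nat \<Rightarrow> nat \<Rightarrow> nat \<Rightarrow> int" where
  "binomial_seq p \<alpha> \<beta> e = int ((p ^ e * \<alpha> - 1) choose (p ^ e * \<beta>))"

definition Stirling_padic :: "nat \<Rightarrow> nat \<Rightarrow> nat \<Rightarrow> nat \<Rightarrow> int" where
  "Stirling_padic p a b = padic_lim p (Stirling_seq p a b)"

definition binomial_padic :: "nat \<Rightarrow> nat \<Rightarrow> nat \<Rightarrow> nat \<Rightarrow> int" where
  "binomial_padic p \<alpha> \<beta> = padic_lim p (binomial_seq p \<alpha> \<beta>)"

lemma binomial_seq_0: "binomial_seq p 0 0 e = 1"
  by (simp add: binomial_seq_def)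

lemma mod_mod_power: "(z mod int p ^ Suc n) mod int p ^ n = z mod int p ^ n"
  by (rule mod_mod_cancel) simp

lemma padic_of_int_carrier:
  assumes "0 < p"
  shows "padic_of_int p z \<in> carrier (padic_int p)"
  using assms by (auto simp: padic_int_def padic_of_int_def mod_mod_power simp del: power_Suc)

lemma cring_padic_int:
  assumes "0 < p"
  shows "cring (padic_int p)"
proof -
  have red: "z mod int p ^ n \<in> {0..<int p ^ n}" for z n
    using assms by simp
  have small: "x n mod int p ^ n = x n" if "x \<in> carrier (padic_int p)" for x n
    using that by (auto simp: padic_int_def)
  have comp: "x (Suc n) mod int p ^ n = x n mod int p ^ n"
    if "x \<in> carrier (padic_int p)" for x n
    using that small[OF that] by (auto simp: padic_int_def)
  have sum_closed: "(\<lambda>n. (x n + y n) mod int p ^ n) \<in> carrier (padic_int p)"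
    if "x \<in> carrier (padic_int p)" "y \<in> carrier (padic_int p)" for x y
  proof -
    have "(x (Suc n) + y (Suc n)) mod int p ^ n = (x n + y n) mod int p ^ n" for n
      by (rule mod_add_cong) (simp_all add: comp that)
    then show ?thesis
      using red by (simp add: padic_int_def mod_mod_power del: power_Suc)
  qed
  have mult_closed: "(\<lambda>n. (x n * y n) mod int p ^ n) \<in> carrier (padic_int p)"
    if "x \<in> carrier (padic_int p)" "y \<in> carrier (padic_int p)" for x y
  proof -
    have "(x (Suc n) * y (Suc n)) mod int p ^ n = (x n * y n) mod int p ^ n" for n
      by (rule mod_mult_cong) (simp_all add: comp that)
    then show ?thesis
      using red by (simp add: padic_int_def mod_mod_power del: power_Suc)
  qed
  have zero: "(\<lambda>n. 0) \<in> carrier (padic_int p)"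
    and one: "(\<lambda>n. 1 mod int p ^ n) \<in> carrier (padic_int p)"
    using padic_of_int_carrier[OF assms, of 0] padic_of_int_carrier[OF assms, of 1]
    by (simp_all add: padic_of_int_def)
  have neg: "\<exists>y\<in>carrier (padic_int p). (\<lambda>n. (y n + x n) mod int p ^ n) = (\<lambda>n. 0)"
    if "x \<in> carrier (padic_int p)" for x
  proof
    show "(\<lambda>n. (- x n) mod int p ^ n) \<in> carrier (padic_int p)"
    proof -
      have "(- x (Suc n)) mod int p ^ n = (- x n) mod int p ^ n" for n
        by (rule mod_minus_cong) (simp add: comp that)
      then show ?thesis
        using red by (simp add: padic_int_def mod_mod_power del: power_Suc)
    qed
    show "(\<lambda>n. ((- x n) mod int p ^ n + x n) mod int p ^ n) = (\<lambda>n. 0)"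
      by (simp add: mod_add_left_eq)
  qed
  have ops: "x \<oplus>\<^bsub>padic_int p\<^esub> y = (\<lambda>n. (x n + y n) mod int p ^ n)"
    "x \<otimes>\<^bsub>padic_int p\<^esub> y = (\<lambda>n. (x n * y n) mod int p ^ n)"
    "\<zero>\<^bsub>padic_int p\<^esub> = (\<lambda>n. 0)" "\<one>\<^bsub>padic_int p\<^esub> = (\<lambda>n. 1 mod int p ^ n)" for x y
    by (simp_all add: padic_int_def)
  show ?thesis
  proof (rule cringI)
    show "abelian_group (padic_int p)"
      by (rule abelian_groupI)
        (use sum_closed zero neg in
          \<open>auto simp: ops small mod_add_left_eq mod_add_right_eq ac_simps\<close>)
    show "comm_monoid (padic_int p)"
      by (rule comm_monoidI)
        (use mult_closed one in
          \<open>auto simp: ops small mod_mult_left_eq mod_mult_right_eq ac_simps\<close>)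
    show "(x \<oplus>\<^bsub>padic_int p\<^esub> y) \<otimes>\<^bsub>padic_int p\<^esub> z =
        x \<otimes>\<^bsub>padic_int p\<^esub> z \<oplus>\<^bsub>padic_int p\<^esub> y \<otimes>\<^bsub>padic_int p\<^esub> z"
      if "x \<in> carrier (padic_int p)" "y \<in> carrier (padic_int p)" "z \<in> carrier (padic_int p)"
      for x y z
      by (simp add: ops mod_mult_left_eq mod_add_eq distrib_right)
  qed
qed

lemma limitin_discrete:
  "limitin (discrete_topology U) f l F \<longleftrightarrow> l \<in> U \<and> (\<forall>\<^sub>F a in F. f a = l)"
proof
  assume L: "limitin (discrete_topology U) f l F"
  then have "l \<in> U"
    by (simp add: limitin_def)
  then have "\<forall>\<^sub>F a in F. f a \<in> {l}"
    using L unfolding limitin_def by (metis openin_discrete_topology singletonI empty_subsetI insert_subset)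
  then show "l \<in> U \<and> (\<forall>\<^sub>F a in F. f a = l)"
    using \<open>l \<in> U\<close> by simp
next
  assume R: "l \<in> U \<and> (\<forall>\<^sub>F a in F. f a = l)"
  then show "limitin (discrete_topology U) f l F"
    by (auto simp: limitin_def elim: eventually_mono)
qed

lemma limitin_padic_iff:
  assumes "0 < p"
  shows "has_padic_limit p X L \<longleftrightarrow>
    L \<in> carrier (padic_int p) \<and> (\<forall>n. \<forall>\<^sub>F e in sequentially. X e mod int p ^ n = L n)"
proof -
  have range: "L n \<in> {0..<int p ^ n}" if "L \<in> carrier (padic_int p)" for n
    using that by (simp add: padic_int_def)
  have top: "padic_of_int p z \<in> (\<Pi>\<^sub>E n\<in>UNIV. {0..<int p ^ n})" for z
    using assms by (auto simp: padic_of_int_def PiE_iff)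
  show ?thesis
    unfolding has_padic_limit_def padic_topology_def limitin_subtopology limitin_componentwise
      limitin_discrete topspace_product_topology topspace_discrete_topology comp_def
    using range top padic_of_int_carrier[OF assms]
    by (auto simp: padic_of_int_def)
qed

lemma has_padic_limit_unique:
  assumes "0 < p" "has_padic_limit p X L" "has_padic_limit p X M"
  shows "L = M"
proof
  fix n
  have "\<forall>\<^sub>F e in sequentially. X e mod int p ^ n = L n \<and> X e mod int p ^ n = M n"
    using assms by (simp add: limitin_padic_iff eventually_conj)
  then have "\<forall>\<^sub>F e in sequentially. L n = M n"
    by (rule eventually_mono) simp
  then show "L n = M n"
    by simp
qed

lemma padic_lim_eqI:
  assumes "0 < p" "has_padic_limit p X L"
  shows "padic_lim p X = L"
  unfolding padic_lim_def using assms has_padic_limit_unique by blast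

end

theory Submission
  imports
    Defs
    "HOL-Computational_Algebra.Polynomial_FPS"
    "HOL-Number_Theory.Residues"
begin

text \<open>
  The generating function of \<open>S(n + k, k)\<close> in \<open>n\<close> is the inverse of the product of
  \<open>1 - i X\<close> over \<open>1 \<le> i \<le> k\<close>.  By Fermat, for \<open>k = p\<close> this product is
  \<open>1 - X ^ (p - 1)\<close> modulo \<open>p\<close>; taking \<open>p\<close>-th powers improves the congruence by one
  power of \<open>p\<close>, so for \<open>k = p ^ (e + 1) b\<close> it is \<open>(1 - X ^ (p - 1)) ^ (p ^ e b)\<close> modulo
  \<open>p ^ e\<close>.  Comparing coefficients of \<open>X ^ (p ^ (e + 1) (a - b))\<close> in the inverses gives \<open>0\<close>
  or a binomial coefficient.  In the same way,
  \<open>(1 - X) ^ (p ^ (e + 1)) = (1 - X ^ p) ^ (p ^ e)\<close> modulo \<open>p ^ (e + 1)\<close> makes the sequence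
  of binomial coefficients a Cauchy sequence.
\<close>

unbundle no vec_syntax
unbundle fps_syntax

section \<open>Congruences in commutative rings\<close>

lemma dvd_diff_trans:
  fixes x y z m :: "'a::comm_ring_1"
  assumes "m dvd x - y" "m dvd y - z"
  shows "m dvd x - z"
  using dvd_add[OF assms] by simp

lemma dvd_diff_mult:
  fixes x y u v m :: "'a::comm_ring_1"
  assumes "m dvd x - y" "m dvd u - v"
  shows "m dvd x * u - y * v"
proof -
  have "x * u - y * v = (x - y) * u + y * (u - v)"
    by (simp add: algebra_simps)
  then show ?thesis
    using assms by simp
qed

lemma dvd_diff_prod:
  fixes f g :: "'i \<Rightarrow> 'a::comm_ring_1"
  assumes "\<And>i. i \<in> I \<Longrightarrow> m dvd f i - g i"
  shows "m dvd prod f I - prod g I"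
  using assms by (induction I rule: infinite_finite_induct) (auto intro: dvd_diff_mult)

lemma dvd_diff_power:
  fixes x y m :: "'a::comm_ring_1"
  assumes "m dvd x - y"
  shows "m dvd x ^ n - y ^ n"
  using assms by (induction n) (auto intro: dvd_diff_mult)

text \<open>From u x = v y = 1 follows u - v = -u v (x - y). This carries congruences between
  products over to the generating functions.\<close>

lemma dvd_diff_inverse:
  fixes x y u v m :: "'a::comm_ring_1"
  assumes "u * x = 1" "v * y = 1" "m dvd x - y"
  shows "m dvd u - v"
proof -
  have "u - v = u * (v * y) - v * (u * x)"
    using assms by simp
  also have "\<dots> = (x - y) * - (u * v)"
    by (simp add: algebra_simps)
  finally show ?thesis
    using assms(3) by simp
qed

text \<open>In x^p - y^p = (x - y) * sum, each of the p terms of the sum is y^(p - 1) modulo p, so p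
  divides the sum. Positivity of \<open>k\<close> supplies x = y modulo p.\<close>

lemma power_Suc_dvd_diff_power:
  fixes x y :: "'a::comm_ring_1"
  assumes "0 < k" "of_nat p ^ k dvd x - y"
  shows "of_nat p ^ Suc k dvd x ^ p - y ^ p"
proof -
  have xy: "of_nat p dvd x - y"
    using assms dvd_power[of k "of_nat p :: 'a"] dvd_trans by blast
  have "of_nat p dvd (\<Sum>i<p. y ^ (p - Suc i) * x ^ i - y ^ (p - Suc i) * y ^ i)"
    by (intro dvd_sum dvd_diff_mult dvd_diff_power xy) auto
  moreover have "(\<Sum>i<p. y ^ (p - Suc i) * y ^ i) = of_nat p * y ^ (p - 1)"
    by (simp flip: power_add)
  ultimately have "of_nat p dvd (\<Sum>i<p. y ^ (p - Suc i) * x ^ i)"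
    by (simp add: sum_subtractf) (metis dvd_triv_left dvd_add diff_add_cancel)
  then have "of_nat p ^ k * of_nat p dvd (x - y) * (\<Sum>i<p. y ^ (p - Suc i) * x ^ i)"
    using assms(2) by (rule mult_dvd_mono[rotated])
  then show ?thesis
    by (simp add: power_diff_sumr2 mult.commute)
qed

lemma power_dvd_diff_power_power:
  fixes x y :: "'a::comm_ring_1"
  assumes "of_nat p dvd x - y"
  shows "of_nat p ^ Suc e dvd x ^ (p ^ e) - y ^ (p ^ e)"
proof (induction e)
  case 0
  then show ?case
    using assms by simp
next
  case (Suc e)
  have "of_nat p ^ Suc (Suc e) dvd (x ^ (p ^ e)) ^ p - (y ^ (p ^ e)) ^ p"
    by (rule power_Suc_dvd_diff_power[OF _ Suc]) simp
  then show ?case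
    by (simp add: mult.commute flip: power_mult)
qed

lemma prime_dvd_freshman:
  fixes x y :: "'a::comm_ring_1"
  assumes "prime p"
  shows "of_nat p dvd (x + y) ^ p - (x ^ p + y ^ p)"
proof -
  have "p > 0"
    using assms by (simp add: prime_gt_0_nat)
  let ?t = "\<lambda>k. of_nat (p choose k) * x ^ k * y ^ (p - k)"
  have "(x + y) ^ p = sum ?t {..p}"
    by (rule binomial_ring)
  also have "{..p} = insert 0 (insert p {1..<p})"
    using \<open>p > 0\<close> by auto
  also have "sum ?t \<dots> = x ^ p + y ^ p + sum ?t {1..<p}"
    using \<open>p > 0\<close> by simp
  finally have "(x + y) ^ p - (x ^ p + y ^ p) = sum ?t {1..<p}"
    by simp
  also have "of_nat p dvd \<dots>"
  proof (rule dvd_sum)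
    fix k assume "k \<in> {1..<p}"
    then have "p dvd (p choose k)"
      using assms by (intro dvd_choose_prime) auto
    then have "(of_nat p :: 'a) dvd of_nat (p choose k)"
      by (auto simp: dvd_def)
    then show "of_nat p dvd ?t k"
      by (simp add: dvd_mult2)
  qed
  finally show ?thesis .
qed

lemma prime_dvd_one_minus_power:
  fixes x :: "'a::comm_ring_1"
  assumes "prime p"
  shows "of_nat p dvd (1 - x) ^ p - (1 - x ^ p)"
proof -
  \<comment> \<open>Expanding 1 as (1 - x) + x avoids the sign of (-x)^p, so p = 2 is no special
    case.\<close>
  have "(1 - x) ^ p - (1 - x ^ p) = - ((1 - x + x) ^ p - ((1 - x) ^ p + x ^ p))"
    by simp
  then show ?thesis
    using prime_dvd_freshman[OF assms, of "1 - x" x] by (simp only: dvd_minus_iff)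
qed

section \<open>Factorization of the polynomial \<open>1 - X ^ (p - 1)\<close> modulo \<open>p\<close>\<close>

text \<open>Lagrange's bound on the number of roots over the field of p elements, phrased over the
  integers. Splitting off X - r leaves a quotient that vanishes modulo p at every other s in
  \<open>R\<close>, as p does not divide s - r.\<close>

lemma prime_dvd_poly_if_many_roots:
  fixes f :: "int poly"
  assumes "prime p" "finite R" "degree f < card R"
    and "\<And>r. r \<in> R \<Longrightarrow> p dvd poly f r"
    and "\<And>r s. r \<in> R \<Longrightarrow> s \<in> R \<Longrightarrow> p dvd r - s \<Longrightarrow> r = s"
  shows "[:p:] dvd f"
  using assms(2-)
proof (induction "degree f" arbitrary: f R rule: less_induct)
  case less
  show ?case
  proof (cases "degree f = 0")
    case True
    then obtain c where "f = [:c:]"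
      by (rule degree_eq_zeroE)
    moreover obtain r where "r \<in> R"
      using less.prems by (metis card.empty less_nat_zero_code ex_in_conv)
    ultimately show ?thesis
      using less.prems(3)[of r] by simp
  next
    case False
    obtain r where r: "r \<in> R"
      using less.prems by (metis card.empty less_nat_zero_code ex_in_conv)
    define q where "q = synthetic_div f r"
    have f: "f = [:-r, 1:] * q + [:poly f r:]"
      using synthetic_div_correct'[of r f] by (simp add: q_def)
    have "degree q < degree f"
      using False by (simp add: q_def degree_synthetic_div)
    moreover have "degree q < card (R - {r})"
      using r less.prems False by (simp add: q_def degree_synthetic_div)
    moreover have "p dvd poly q s" if "s \<in> R - {r}" for s
    proof -
      have "poly f s = (s - r) * poly q s + poly f r"
        by (subst f) (simp add: algebra_simps)
      then have "p dvd (s - r) * poly q s"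
        using less.prems(3)[of s] less.prems(3)[of r] that r
        by (metis DiffD1 dvd_add_left_iff)
      then show ?thesis
        using less.prems(4)[of s r] that r assms(1) by (auto simp: prime_dvd_mult_iff)
    qed
    ultimately have "[:p:] dvd q"
      using less.prems by (intro less.hyps) auto
    then show ?thesis
      using less.prems(3)[OF r] by (subst f) (intro dvd_add dvd_mult, simp_all)
  qed
qed

text \<open>The difference has degree at most p - 1 but vanishes modulo p at all p residues: at 0
  both polynomials are 1, and elsewhere both are 0 modulo p, the second one by Fermat.\<close>

lemma prime_dvd_prod_poly:
  assumes "prime (p::nat)"
  shows "[:int p:] dvd (\<Prod>i\<in>{1..<p}. [:1, - int i:]) - (1 - Polynomial.monom 1 (p - 1))"
proof (rule prime_dvd_poly_if_many_roots)
  let ?P = "\<Prod>i\<in>{1..<p}. [:1, - int i:]"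
  have "p > 1"
    using assms by (rule prime_gt_1_nat)
  show "prime (int p)"
    using assms by simp
  show "finite {0..<int p}"
    by simp
  have "degree ?P \<le> (\<Sum>i\<in>{1..<p}. degree [:1, - int i:])"
    using degree_prod_sum_le[of "{1..<p}" "\<lambda>i. [:1, - int i:]"] by (simp add: comp_def)
  also have "\<dots> \<le> (\<Sum>i\<in>{1..<p}. 1)"
    by (intro sum_mono) simp
  finally have "degree ?P \<le> p - 1"
    by simp
  moreover have "degree (1 - Polynomial.monom (1::int) (p - 1)) \<le> p - 1"
    by (intro degree_diff_le) (simp_all add: Polynomial.degree_monom_le)
  ultimately have "degree (?P - (1 - Polynomial.monom 1 (p - 1))) \<le> p - 1"
    by (rule degree_diff_le)
  then show "degree (?P - (1 - Polynomial.monom 1 (p - 1))) < card {0..<int p}"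
    using \<open>p > 1\<close> by simp
  show "int p dvd poly (?P - (1 - Polynomial.monom 1 (p - 1))) r" if "r \<in> {0..<int p}" for r
  proof (cases "r = 0")
    case True
    then show ?thesis
      using \<open>p > 1\<close> by (simp add: poly_prod poly_monom power_0_left)
  next
    case False
    then have r: "\<not> p dvd nat r"
      using that by (auto dest: dvd_imp_le)
    have "[nat r ^ (p - 1) = 1] (mod p)"
      using assms r by (rule fermat_theorem)
    then have "[int (nat r ^ (p - 1)) = int 1] (mod int p)"
      by (simp only: cong_int_iff)
    then have "int p dvd r ^ (p - 1) - 1"
      using that by (simp add: cong_iff_dvd_diff)
    moreover have "int p dvd poly ?P r"
    proof -
      have "coprime (nat r) p"
        using assms r by (simp add: prime_imp_coprime coprime_commute)
      \<comment> \<open>For s inverse to r modulo p, the factor 1 - s X vanishes at r.\<close>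
      then obtain s where s: "s < p" "[nat r * s = 1] (mod p)"
        using \<open>p > 1\<close> coprime_iff_invertible'_nat[of p "nat r"] by (auto simp: cong_def)
      then have "s \<noteq> 0"
        using s(2) \<open>p > 1\<close> by (cases s) (auto simp: cong_def)
      have "[int (nat r * s) = int 1] (mod int p)"
        using s(2) by (simp only: cong_int_iff)
      then have "int p dvd r * int s - 1"
        using that by (simp add: cong_iff_dvd_diff)
      then have "int p dvd poly [:1, - int s:] r"
        by (subst dvd_minus_iff[symmetric]) (simp add: algebra_simps)
      also have "\<dots> dvd poly ?P r"
        unfolding poly_prod using s(1) \<open>s \<noteq> 0\<close> by (intro dvd_prodI) auto
      finally show ?thesis .
    qed
    ultimately have "int p dvd poly ?P r + (r ^ (p - 1) - 1)"
      by (rule dvd_add[rotated])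
    then show ?thesis
      by (simp add: poly_monom algebra_simps)
  qed
  show "r = s" if "r \<in> {0..<int p}" "s \<in> {0..<int p}" "int p dvd r - s" for r s
    using that by (auto simp flip: mod_eq_dvd_iff)
qed

section \<open>Generating functions\<close>

lemma of_nat_dvd_fps_nth:
  fixes F :: "int fps"
  assumes "of_nat m dvd F"
  shows "int m dvd F $ n"
  using assms by (auto simp: dvd_def simp flip: fps_of_nat)

text \<open>Counting from 0 makes the blocks of m factors the intervals
  \<open>{j * m..<j * m + m}\<close>.\<close>

definition linear_prod :: "nat \<Rightarrow> int fps" where
  "linear_prod k = (\<Prod>i<k. 1 - of_nat (Suc i) * fps_X)"

text \<open>The shift by \<open>k\<close> removes the leading power X^k; the constant coefficient
  S(k, k) = 1 makes the series invertible over the integers.\<close>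

definition Stirling_fps :: "nat \<Rightarrow> int fps" where
  "Stirling_fps k = Abs_fps (\<lambda>n. int (Stirling (n + k) k))"

text \<open>The inverse of \<open>(1 - X ^ d) ^ c\<close>; the truncated subtraction is harmless for
  \<open>c = 0\<close>, where only the constant term survives.\<close>

definition neg_binomial_fps :: "nat \<Rightarrow> nat \<Rightarrow> int fps" where
  "neg_binomial_fps d c =
    Abs_fps (\<lambda>n. if d dvd n then int ((n div d + c - 1) choose (n div d)) else 0)"

text \<open>By S(n + 1, k + 1) = (k + 1) S(n, k + 1) + S(n, k), the factor 1 - (k + 1) X lowers k +
  1 to k.\<close>

lemma Stirling_fps_mult_linear_prod: "Stirling_fps k * linear_prod k = 1"
proof (induction k)
  case 0
  have "Stirling_fps 0 $ n = 1 $ n" for n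
    by (cases n) (auto simp: Stirling_fps_def)
  then show ?case
    by (simp add: linear_prod_def fps_eq_iff)
next
  case (Suc k)
  have "(Stirling_fps (Suc k) * (1 - of_nat (Suc k) * fps_X)) $ n = Stirling_fps k $ n" for n
  proof -
    have "Stirling_fps (Suc k) * (1 - of_nat (Suc k) * fps_X) =
      Stirling_fps (Suc k) - fps_const (int (Suc k)) * (fps_X * Stirling_fps (Suc k))"
      by (simp add: algebra_simps flip: fps_of_nat)
    then show ?thesis
      by (cases n) (auto simp: Stirling_fps_def algebra_simps)
  qed
  then have "Stirling_fps (Suc k) * (1 - of_nat (Suc k) * fps_X) = Stirling_fps k"
    by (rule fps_ext)
  moreover have "linear_prod (Suc k) = (1 - of_nat (Suc k) * fps_X) * linear_prod k"
    by (simp add: linear_prod_def)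
  ultimately show ?case
    using Suc by (metis mult.assoc)
qed

text \<open>By Pascal's rule at the multiples of \<open>d\<close>, the factor 1 - X^d lowers c + 1
  to c.\<close>

lemma neg_binomial_fps_mult:
  assumes "0 < d"
  shows "neg_binomial_fps d c * (1 - fps_X ^ d) ^ c = 1"
proof (induction c)
  case 0
  have "neg_binomial_fps d 0 $ n = 1 $ n" for n
    using assms by (auto simp: neg_binomial_fps_def dvd_div_eq_0_iff intro!: binomial_eq_0)
  then show ?case
    by (simp add: fps_eq_iff)
next
  case (Suc c)
  have "(neg_binomial_fps d (Suc c) * (1 - fps_X ^ d)) $ n = neg_binomial_fps d c $ n" for n
  proof -
    have *: "(neg_binomial_fps d (Suc c) * (1 - fps_X ^ d)) $ n =
      neg_binomial_fps d (Suc c) $ n -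
        (if n < d then 0 else neg_binomial_fps d (Suc c) $ (n - d))"
      by (simp add: right_diff_distrib fps_X_power_mult_right_nth)
    show ?thesis
    proof (cases "d dvd n")
      case False
      then show ?thesis
        unfolding * by (auto simp: neg_binomial_fps_def dvd_minus_self)
    next
      case True
      then obtain q where n: "n = d * q"
        by (rule dvdE)
      show ?thesis
      proof (cases q)
        case 0
        then show ?thesis
          using assms unfolding * by (simp add: n neg_binomial_fps_def)
      next
        case (Suc r)
        have "d * Suc r - d = d * r"
          by simp
        then show ?thesis
          using assms unfolding * by (simp add: n Suc neg_binomial_fps_def del: mult_Suc_right)
      qed
    qed
  qed
  then have "neg_binomial_fps d (Suc c) * (1 - fps_X ^ d) = neg_binomial_fps d c"
    by (simp add: fps_eq_iff)
  then show ?case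
    using Suc by (simp add: mult.assoc[symmetric])
qed

text \<open>The factors form \<open>n\<close> blocks of length \<open>m\<close>. Since i + j m is i
  modulo m, each block is congruent to the first.\<close>

lemma linear_prod_mult:
  "of_nat m dvd linear_prod (n * m) - linear_prod m ^ n"
proof -
  let ?g = "\<lambda>i. 1 - of_nat (Suc i) * fps_X :: int fps"
  have shift: "prod g {j * m..<j * m + m} = (\<Prod>i<m. g (i + j * m))"
    for g :: "nat \<Rightarrow> int fps" and j
    using prod.shift_bounds_nat_ivl[of g 0 "j * m" m]
    by (simp add: lessThan_atLeast0 add.commute)
  have "linear_prod (n * m) = (\<Prod>j<n. prod ?g {j * m..<j * m + m})"
    by (simp add: linear_prod_def prod.nat_group)
  also have "\<dots> = (\<Prod>j<n. \<Prod>i<m. ?g (i + j * m))"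
    by (simp only: shift)
  finally have "linear_prod (n * m) - linear_prod m ^ n =
    (\<Prod>j<n. \<Prod>i<m. ?g (i + j * m)) - (\<Prod>j<n. \<Prod>i<m. ?g i)"
    by (simp add: linear_prod_def)
  also have "of_nat m dvd \<dots>"
  proof (intro dvd_diff_prod)
    fix i j
    have "?g (i + j * m) - ?g i = of_nat m * (- of_nat j * fps_X)"
      by (simp add: algebra_simps)
    then show "of_nat m dvd ?g (i + j * m) - ?g i"
      by simp
  qed
  finally show ?thesis .
qed

lemma linear_prod_prime:
  assumes "prime p"
  shows "of_nat p dvd linear_prod p - (1 - fps_X ^ (p - 1))"
proof -
  have "p > 0"
    using assms by (simp add: prime_gt_0_nat)
  let ?P = "\<Prod>i\<in>{1..<p}. [:1, - int i:]"
  have "fps_of_poly ?P = (\<Prod>i\<in>{1..<p}. 1 - of_nat i * fps_X)"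
    by (simp add: fps_of_poly_prod fps_of_poly_pCons flip: fps_of_nat fps_const_neg)
  also have "\<dots> = (\<Prod>i<p - 1. 1 - of_nat (Suc i) * fps_X)"
    using \<open>p > 0\<close> prod.shift_bounds_Suc_ivl[of "\<lambda>i. 1 - of_nat i * fps_X :: int fps" 0 "p - 1"]
    by (simp add: lessThan_atLeast0)
  finally have P: "fps_of_poly ?P = linear_prod (p - 1)"
    by (simp add: linear_prod_def)
  obtain Q where "?P - (1 - Polynomial.monom 1 (p - 1)) = [:int p:] * Q"
    using prime_dvd_prod_poly[OF assms] by (rule dvdE)
  then have "fps_of_poly (?P - (1 - Polynomial.monom 1 (p - 1))) = fps_of_poly ([:int p:] * Q)"
    by simp
  then have "linear_prod (p - 1) - (1 - fps_X ^ (p - 1)) = of_nat p * fps_of_poly Q"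
    by (simp add: fps_of_poly_diff fps_of_poly_mult P fps_of_poly_monom' fps_of_poly_const fps_of_nat
      del: mult_pCons_left One_nat_def)
  \<comment> \<open>The extra factor 1 - p X is 1 modulo p; it completes the block of length
    p.\<close>
  moreover have "linear_prod p = linear_prod (p - 1) * (1 - of_nat p * fps_X)"
    using \<open>p > 0\<close> by (cases p) (simp_all add: linear_prod_def)
  then have "linear_prod p - linear_prod (p - 1) = of_nat p * (- fps_X * linear_prod (p - 1))"
    by (simp add: algebra_simps)
  ultimately show ?thesis
    by (metis dvd_diff_trans dvd_triv_left)
qed

text \<open>Blocks of length p^(e + 1) agree only modulo p^(e + 1), so the exponent of the modulus
  lags one behind that of the length.\<close>

lemma linear_prod_prime_power:
  assumes "prime p"
  shows "of_nat p ^ e dvd linear_prod (p ^ Suc e) - (1 - fps_X ^ (p - 1)) ^ p ^ e"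
proof (induction e)
  case 0
  show ?case
    by simp
next
  case (Suc e)
  have "of_nat p ^ Suc e dvd linear_prod (p ^ Suc (Suc e)) - linear_prod (p ^ Suc e) ^ p"
    using linear_prod_mult[of "p ^ Suc e" p] by simp
  moreover have "of_nat p ^ Suc e dvd
    linear_prod (p ^ Suc e) ^ p - ((1 - fps_X ^ (p - 1)) ^ p ^ e) ^ p"
  \<comment> \<open>For e = 0 the induction hypothesis is a congruence modulo 1 and cannot be
    lifted; \<open>linear_prod_prime\<close> replaces it.\<close>
  proof (cases "e = 0")
    case True
    then show ?thesis
      using dvd_diff_power[OF linear_prod_prime[OF assms]] by simp
  next
    case False
    then show ?thesis
      using Suc by (intro power_Suc_dvd_diff_power) auto
  qed
  ultimately show ?case
    using dvd_diff_trans by (fastforce simp: mult.commute simp flip: power_mult)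
qed

section \<open>Congruences for the two sequences\<close>

lemma Stirling_seq_cong:
  assumes "prime p" "b \<le> a"
  shows "[Stirling_seq p a b (Suc e) =
    neg_binomial_fps (p - 1) (p ^ e * b) $ (p ^ Suc e * (a - b))] (mod int p ^ e)"
proof -
  let ?k = "p ^ Suc e * b"
  have "(of_nat p ^ Suc e :: int fps) dvd linear_prod ?k - linear_prod (p ^ Suc e) ^ b"
    using linear_prod_mult[of "p ^ Suc e" b] by (simp add: mult.commute)
  then have "(of_nat p ^ e :: int fps) dvd linear_prod ?k - linear_prod (p ^ Suc e) ^ b"
    by (metis power_Suc dvd_mult_right)
  moreover have "of_nat p ^ e dvd
      linear_prod (p ^ Suc e) ^ b - ((1 - fps_X ^ (p - 1)) ^ p ^ e) ^ b"
    using assms by (intro dvd_diff_power linear_prod_prime_power)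
  ultimately have "of_nat p ^ e dvd linear_prod ?k - (1 - fps_X ^ (p - 1)) ^ (p ^ e * b)"
    unfolding power_mult by (rule dvd_diff_trans)
  then have "of_nat p ^ e dvd Stirling_fps ?k - neg_binomial_fps (p - 1) (p ^ e * b)"
    using assms prime_gt_1_nat[of p]
    by (intro dvd_diff_inverse[OF Stirling_fps_mult_linear_prod neg_binomial_fps_mult]) auto
  then have "of_nat (p ^ e) dvd Stirling_fps ?k - neg_binomial_fps (p - 1) (p ^ e * b)"
    by simp
  \<comment> \<open>This exponent plus \<open>?k\<close> is \<open>p ^ Suc e * a\<close>, as the
    shift in \<open>Stirling_fps\<close> requires.\<close>
  from of_nat_dvd_fps_nth[OF this, of "p ^ Suc e * (a - b)"]
  show ?thesis
    using assms
    by (simp add: cong_iff_dvd_diff Stirling_seq_def Stirling_fps_def flip: distrib_left)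
qed

text \<open>Changing \<open>d\<close> only spaces out the coefficients. The values 1, p and p - 1
  are used below.\<close>

lemma binomial_seq_eq_fps:
  assumes "0 < d" "\<beta> \<le> \<alpha>"
  shows "binomial_seq p \<alpha> \<beta> e = neg_binomial_fps d (p ^ e * (\<alpha> - \<beta>)) $ (d * (p ^ e * \<beta>))"
  using assms by (simp add: binomial_seq_def neg_binomial_fps_def flip: distrib_left)

lemma binomial_seq_cong:
  assumes "prime p" "\<beta> \<le> \<alpha>"
  shows "[binomial_seq p \<alpha> \<beta> (Suc e) = binomial_seq p \<alpha> \<beta> e] (mod int p ^ Suc e)"
proof -
  let ?c = "\<alpha> - \<beta>"
  have "p > 0"
    using assms by (simp add: prime_gt_0_nat)
  have "(of_nat p ^ Suc e :: int fps) dvd ((1 - fps_X) ^ p) ^ p ^ e - (1 - fps_X ^ p) ^ p ^ e"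
    by (intro power_dvd_diff_power_power prime_dvd_one_minus_power assms)
  then have "(of_nat p ^ Suc e :: int fps) dvd
      (((1 - fps_X) ^ p) ^ p ^ e) ^ ?c - ((1 - fps_X ^ p) ^ p ^ e) ^ ?c"
    by (rule dvd_diff_power)
  then have "(of_nat p ^ Suc e :: int fps) dvd
      (1 - fps_X ^ 1) ^ (p ^ Suc e * ?c) - (1 - fps_X ^ p) ^ (p ^ e * ?c)"
    by (simp add: mult.assoc flip: power_mult)
  then have "of_nat p ^ Suc e dvd
      neg_binomial_fps 1 (p ^ Suc e * ?c) - neg_binomial_fps p (p ^ e * ?c)"
    using \<open>p > 0\<close> by (intro dvd_diff_inverse[OF neg_binomial_fps_mult neg_binomial_fps_mult]) auto
  then have "of_nat (p ^ Suc e) dvd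
      neg_binomial_fps 1 (p ^ Suc e * ?c) - neg_binomial_fps p (p ^ e * ?c)"
    by simp
  \<comment> \<open>The same exponent yields the term \<open>Suc e\<close> in the series with d = 1
    and the term \<open>e\<close> in the one with d = p.\<close>
  from of_nat_dvd_fps_nth[OF this, of "p ^ Suc e * \<beta>"]
  show ?thesis
    using binomial_seq_eq_fps[of 1 \<beta> \<alpha> p "Suc e"] binomial_seq_eq_fps[of p \<beta> \<alpha> p e]
      assms \<open>p > 0\<close>
    by (simp add: cong_iff_dvd_diff mult.assoc)
qed

section \<open>Limits\<close>

text \<open>From index n on, the sequence is constant modulo p^n; this constant is the n-th residue
  of the limit.\<close>

lemma has_padic_limit_Cauchy:
  assumes "0 < p" and X: "\<And>e. [X (Suc e) = X e] (mod int p ^ e)"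
  shows "has_padic_limit p X (\<lambda>n. X n mod int p ^ n)"
proof -
  have "X e mod int p ^ n = X n mod int p ^ n" if "n \<le> e" for n e
    using that
  proof (induction e rule: dec_induct)
    case (step e)
    have "[X (Suc e) = X e] (mod int p ^ n)"
      using X by (rule cong_dvd_modulus) (simp add: le_imp_power_dvd step)
    then show ?case
      using step by (simp add: cong_def)
  qed simp
  then have "\<forall>\<^sub>F e in sequentially. X e mod int p ^ n = X n mod int p ^ n" for n
    unfolding eventually_sequentially by blast
  moreover have "(X (Suc n) mod int p ^ Suc n) mod int p ^ n = X n mod int p ^ n" for n
    using X[of n] by (simp only: mod_mod_power cong_def)
  ultimately show ?thesis
    using \<open>0 < p\<close> by (simp add: limitin_padic_iff padic_int_def del: power_Suc)
qed

text \<open>Absorbs the index shift in \<open>Stirling_seq_cong\<close>: modulo a fixed p^n, the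
  shifted sequence eventually agrees with \<open>X\<close>.\<close>

lemma has_padic_limit_shift_cong:
  assumes "0 < p" "has_padic_limit p X L" "\<And>e. [Y (Suc e) = X e] (mod int p ^ e)"
  shows "has_padic_limit p Y L"
proof -
  have "\<forall>\<^sub>F e in sequentially. Y e mod int p ^ n = L n" for n
  proof -
    have "\<forall>\<^sub>F e in sequentially. X e mod int p ^ n = L n \<and> n \<le> e"
      using assms by (simp add: limitin_padic_iff eventually_conj eventually_ge_at_top)
    then have "\<forall>\<^sub>F e in sequentially. Y (Suc e) mod int p ^ n = L n"
    proof (rule eventually_mono)
      fix e assume e: "X e mod int p ^ n = L n \<and> n \<le> e"
      have "[Y (Suc e) = X e] (mod int p ^ n)"
        using assms(3) by (rule cong_dvd_modulus) (simp add: le_imp_power_dvd e)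
      then show "Y (Suc e) mod int p ^ n = L n"
        using e by (simp add: cong_def)
    qed
    then show ?thesis
      by (simp add: eventually_sequentially_Suc[of "\<lambda>e. Y e mod int p ^ n = L n"])
  qed
  then show ?thesis
    using assms by (simp add: limitin_padic_iff)
qed

theorem theorem1p2:
  fixes p a b :: nat
  assumes "prime p" and "b \<le> a"
  shows "padic_convergent p (Stirling_seq p a b) \<and>
    (\<not> [a = b] (mod (p - 1)) \<longrightarrow> Stirling_padic p a b = \<zero>\<^bsub>padic_int p\<^esub>) \<and>
    ([a = b] (mod (p - 1)) \<longrightarrow>
      padic_convergent p
        (binomial_seq p ((p * a - b) div (p - 1)) ((p * (a - b)) div (p - 1))) \<and>
      Stirling_padic p a b =
        binomial_padic p ((p * a - b) div (p - 1)) ((p * (a - b)) div (p - 1)))"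
proof (cases "[a = b] (mod (p - 1))")
  case False
  have p: "p > 1"
    using assms(1) by (rule prime_gt_1_nat)
  \<comment> \<open>Powers of p cannot make p - 1 divide the exponent, so only vanishing
    coefficients are met.\<close>
  have "coprime (p - 1) p"
    using p by (intro coprime_diff_one_left_nat) simp
  then have "coprime (p - 1) (p ^ Suc e)" for e
    by (simp del: power_Suc)
  then have "\<not> p - 1 dvd p ^ Suc e * (a - b)" for e
    using False assms(2) by (metis coprime_dvd_mult_right_iff cong_altdef_nat)
  then have zero: "[Stirling_seq p a b (Suc e) = 0] (mod int p ^ e)" for e
    using Stirling_seq_cong[OF assms, of e] by (simp add: neg_binomial_fps_def)
  have "has_padic_limit p (\<lambda>e. 0) (\<lambda>n. 0)"
    using has_padic_limit_Cauchy[of p "\<lambda>e. 0"] p by simp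
  then have "has_padic_limit p (Stirling_seq p a b) (\<lambda>n. 0)"
    using has_padic_limit_shift_cong[of p "\<lambda>e. 0"] zero p by simp
  then show ?thesis
    using False p padic_lim_eqI[of p]
    by (auto simp: padic_convergent_def Stirling_padic_def padic_int_def)
next
  case True
  have p: "p > 1"
    using assms(1) by (rule prime_gt_1_nat)
  obtain c where c: "a - b = (p - 1) * c"
    using True assms(2) by (metis cong_altdef_nat dvdE)
  \<comment> \<open>These are the two quotients by p - 1, both exact because p a - b = p (a - b) +
    (p - 1) b.\<close>
  define \<alpha> \<beta> where "\<alpha> = b + p * c" and "\<beta> = p * c"
  have "p * a - b = p * (a - b) + (p - 1) * b"
    using assms(2) p by (simp add: diff_mult_distrib diff_mult_distrib2)
  then have "p * a - b = (p - 1) * \<alpha>"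
    by (simp add: c \<alpha>_def algebra_simps)
  then have \<alpha>: "(p * a - b) div (p - 1) = \<alpha>"
    using p by simp
  have "p * (a - b) = (p - 1) * \<beta>"
    by (simp add: c \<beta>_def)
  then have \<beta>: "(p * (a - b)) div (p - 1) = \<beta>"
    using p by simp
  have "[binomial_seq p \<alpha> \<beta> (Suc e) = binomial_seq p \<alpha> \<beta> e] (mod int p ^ e)" for e
    by (rule cong_dvd_modulus[OF binomial_seq_cong]) (simp_all add: assms \<alpha>_def \<beta>_def)
  then obtain L where L: "has_padic_limit p (binomial_seq p \<alpha> \<beta>) L"
    using has_padic_limit_Cauchy p by (metis less_trans zero_less_one)
  \<comment> \<open>Here \<alpha> - \<beta> = b and (p - 1) \<beta> = p (a - b), so power and
    exponent match the case d = p - 1.\<close>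
  have "neg_binomial_fps (p - 1) (p ^ e * b) $ (p ^ Suc e * (a - b)) = binomial_seq p \<alpha> \<beta> e" for e
    using binomial_seq_eq_fps[of "p - 1" \<beta> \<alpha> p e] p
    by (simp add: \<alpha>_def \<beta>_def c ac_simps)
  then have "[Stirling_seq p a b (Suc e) = binomial_seq p \<alpha> \<beta> e] (mod int p ^ e)" for e
    using Stirling_seq_cong[OF assms, of e] by simp
  then have "has_padic_limit p (Stirling_seq p a b) L"
    using has_padic_limit_shift_cong L p by (metis less_trans zero_less_one)
  then show ?thesis
    using True L p padic_lim_eqI[of p] unfolding \<alpha> \<beta>
    by (auto simp: padic_convergent_def Stirling_padic_def binomial_padic_def)
qed

end
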